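(* For $q$ in general position in $V=\mathbb{C}^{N^2}$ there are no constants in $\mathcal{B}_q$. The set of exceptional points in $V$ (those $q$ for which constants exist in $\mathcal{B}_q$) is determined by polynomial equations in the $q_{ij}$, $i,j=1,\dots,N$.
   Context: Let $\mathcal{B}=\bigoplus_{n\ge0}\mathcal{B}(n)$ be the unital associative $\mathbb{C}$-algebra freely generated by $\xi_1,\dots,\xi_N$, graded by degree. Given parameters $q=(q_{ij})$, viewed as a point of $V=\mathbb{C}^{N^2}$, $\mathcal{B}_q$ denotes $\mathcal{B}$ equipped with the linear operators $\partial_i$ ($i=1,\dots,N$) determined by $\partial_i1=0$ and $\partial_i(\xi_jx)=\delta_{ij}x+q_{ij}\xi_j\partial_ix$ for all $x\in\mathcal{B}$. A constant in $\mathcal{B}_q$ is a nonzero element $C\in\bigoplus_{n\ge1}\mathcal{B}(n)$ with $\partial_iC=0$ for $i=1,\dots,N$. *)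

theory Defs
  imports "HOL-Analysis.Analysis" "HOL-Library.Poly_Mapping"
begin

section \<open>The free algebra\<close>

datatype 'a word = Word (letters: "'a list")

instantiation word :: (type) monoid_add
begin

definition zero_word :: "'a word" where
  "0 = Word []"

definition plus_word :: "'a word \<Rightarrow> 'a word \<Rightarrow> 'a word" where
  "u + v = Word (letters u @ letters v)"

instance
  by standard (simp_all add: zero_word_def plus_word_def)

end

text \<open>The algebra of the free monoid on \<open>'n\<close>, with the convolution product of
  \<^theory>\<open>HOL-Library.Poly_Mapping\<close>. The generators are indexed by a finite type \<open>'n\<close>, so that
  \<open>N = CARD('n)\<close>.\<close>

type_synonym 'n free_alg = "'n word \<Rightarrow>\<^sub>0 complex"

definition xi :: "'n \<Rightarrow> 'n free_alg" where
  "xi j = Poly_Mapping.single (Word [j]) 1"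

definition smul :: "complex \<Rightarrow> 'n free_alg \<Rightarrow> 'n free_alg" where
  "smul c x = Poly_Mapping.map ((*) c) x"

lemma smul_conv_mult: "smul c x = Poly_Mapping.single 0 c * x"
  by (simp add: smul_def mult_map_scale_conv_mult)

lemma lookup_smul [simp]: "Poly_Mapping.lookup (smul c x) w = c * Poly_Mapping.lookup x w"
  by (simp add: smul_def Poly_Mapping.map.rep_eq when_def)

interpretation free_alg: vector_space "smul :: complex \<Rightarrow> 'n free_alg \<Rightarrow> 'n free_alg"
  by unfold_locales (auto intro!: poly_mapping_eqI simp: lookup_add algebra_simps)

definition homogeneous :: "nat \<Rightarrow> 'n free_alg set" where
  "homogeneous n = {x. \<forall>w\<in>Poly_Mapping.keys x. length (letters w) = n}"

definition positive_part :: "'n free_alg set" where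
  "positive_part = free_alg.span (\<Union>n\<in>{1..}. homogeneous n)"


section \<open>The twisted derivations and the constants\<close>

text \<open>Parameters are points \<open>q\<close> of \<open>complex ^ ('n \<times> 'n)\<close>, with \<open>q $ (i, j)\<close> for \<open>q\<^sub>i\<^sub>j\<close>. The
  operators are defined on words and extended linearly; \<open>partial_linear\<close>, \<open>partial_one\<close>,
  \<open>partial_xi_mult\<close> and \<open>partial_unique\<close> below are their characterization.\<close>

primrec partial_word :: "complex ^ ('n \<times> 'n) \<Rightarrow> 'n::finite \<Rightarrow> 'n list \<Rightarrow> 'n free_alg" where
  "partial_word q i [] = 0"
| "partial_word q i (j # w) =
     (if i = j then Poly_Mapping.single (Word w) 1 else 0)
     + smul (q $ (i, j)) (xi j * partial_word q i w)"

definition partial :: "complex ^ ('n \<times> 'n) \<Rightarrow> 'n::finite \<Rightarrow> 'n free_alg \<Rightarrow> 'n free_alg" where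
  "partial q i x = (\<Sum>w\<in>Poly_Mapping.keys x. smul (Poly_Mapping.lookup x w) (partial_word q i (letters w)))"

definition constants :: "complex ^ ('n \<times> 'n) \<Rightarrow> 'n::finite free_alg set" where
  "constants q = {C \<in> positive_part. C \<noteq> 0 \<and> (\<forall>i. partial q i C = 0)}"

lemma partial_superset:
  assumes "finite A" "Poly_Mapping.keys x \<subseteq> A"
  shows "partial q i x = (\<Sum>w\<in>A. smul (Poly_Mapping.lookup x w) (partial_word q i (letters w)))"
  unfolding partial_def
  by (rule sum.mono_neutral_left) (use assms in \<open>auto simp: in_keys_iff\<close>)

lemma partial_add: "partial q i (x + y) = partial q i x + partial q i y"
proof -
  let ?A = "Poly_Mapping.keys x \<union> Poly_Mapping.keys y"
  have "Poly_Mapping.keys (x + y) \<subseteq> ?A" by (rule keys_add)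
  then show ?thesis
    by (simp add: partial_superset[of ?A] lookup_add free_alg.scale_left_distrib sum.distrib)
qed

lemma partial_smul: "partial q i (smul c x) = smul c (partial q i x)"
proof -
  have "Poly_Mapping.keys (smul c x) \<subseteq> Poly_Mapping.keys x" by (auto simp: in_keys_iff)
  then show ?thesis
    by (simp add: partial_superset[of "Poly_Mapping.keys x"] free_alg.scale_sum_right)
qed

lemma partial_linear: "Vector_Spaces.linear smul smul (partial q i)"
  by unfold_locales (simp_all add: partial_add partial_smul)

lemma partial_single: "partial q i (Poly_Mapping.single w 1) = partial_word q i (letters w)"
  by (simp add: partial_def)

lemma partial_one: "partial q i 1 = 0"
  by (simp add: partial_single zero_word_def flip: single_one)

lemma free_alg_expand:
  "x = (\<Sum>w\<in>Poly_Mapping.keys x. smul (Poly_Mapping.lookup x w) (Poly_Mapping.single w 1))"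
proof (rule poly_mapping_eqI)
  fix v
  have "(\<Sum>w\<in>Poly_Mapping.keys x. Poly_Mapping.lookup x w * (1 when w = v))
      = (\<Sum>w\<in>Poly_Mapping.keys x. if w = v then Poly_Mapping.lookup x w else 0)"
    by (rule sum.cong) auto
  then show "Poly_Mapping.lookup x v = Poly_Mapping.lookup
      (\<Sum>w\<in>Poly_Mapping.keys x. smul (Poly_Mapping.lookup x w) (Poly_Mapping.single w 1)) v"
    by (simp add: lookup_sum lookup_single in_keys_iff)
qed

lemma linear_eq_on_words:
  assumes "Vector_Spaces.linear smul smul f" "Vector_Spaces.linear smul smul g"
    and eq: "\<And>w. f (Poly_Mapping.single w 1) = g (Poly_Mapping.single w 1)"
  shows "f x = g x"
proof -
  interpret f: Vector_Spaces.linear smul smul f by fact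
  interpret g: Vector_Spaces.linear smul smul g by fact
  show ?thesis
    unfolding arg_cong[OF free_alg_expand[of x], of f] arg_cong[OF free_alg_expand[of x], of g]
      f.sum g.sum f.scale g.scale eq ..
qed

lemma xi_mult_single: "xi j * Poly_Mapping.single (Word w) c = Poly_Mapping.single (Word (j # w)) c"
  by (simp add: xi_def mult_single plus_word_def)

lemma xi_mult_smul: "xi j * smul c x = smul c (xi j * x)"
proof -
  have "xi j * Poly_Mapping.single 0 c = Poly_Mapping.single 0 c * xi j"
    by (simp add: xi_def mult_single)
  then show ?thesis
    by (simp add: smul_conv_mult flip: mult.assoc)
qed

lemma partial_xi_mult:
  "partial q i (xi j * x) = (if i = j then x else 0) + smul (q $ (i, j)) (xi j * partial q i x)"
proof (rule linear_eq_on_words[of "\<lambda>x. partial q i (xi j * x)"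
      "\<lambda>x. (if i = j then x else 0) + smul (q $ (i, j)) (xi j * partial q i x)" x])
  show "Vector_Spaces.linear smul smul (\<lambda>x. partial q i (xi j * x))"
    by unfold_locales (simp_all add: distrib_left xi_mult_smul partial_add partial_smul)
  show "Vector_Spaces.linear smul smul
      (\<lambda>x. (if i = j then x else 0) + smul (q $ (i, j)) (xi j * partial q i x))"
    by unfold_locales (simp_all add: distrib_left xi_mult_smul partial_add partial_smul
        free_alg.scale_right_distrib mult.commute)
  fix w :: "'a word"
  show "partial q i (xi j * Poly_Mapping.single w 1) = (if i = j then Poly_Mapping.single w 1 else 0)
      + smul (q $ (i, j)) (xi j * partial q i (Poly_Mapping.single w 1))"
    by (cases w) (simp add: xi_mult_single partial_single)
qed

lemma partial_unique:
  assumes lin: "\<And>i. Vector_Spaces.linear smul smul (D i)"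
    and one: "\<And>i. D i 1 = 0"
    and xi: "\<And>i j x. D i (xi j * x) = (if i = j then x else 0) + smul (q $ (i, j)) (xi j * D i x)"
  shows "D = partial q"
proof (intro ext, rule linear_eq_on_words[OF lin partial_linear])
  fix i and w :: "'a word"
  have "D i (Poly_Mapping.single (Word v) 1) = partial_word q i v" for v
  proof (induction v)
    case Nil
    then show ?case using one[of i] by (simp add: zero_word_def flip: single_one)
  next
    case (Cons j v)
    then show ?case by (simp add: xi flip: xi_mult_single)
  qed
  from this[of "letters w"]
  show "D i (Poly_Mapping.single w 1) = partial q i (Poly_Mapping.single w 1)"
    by (simp add: partial_single)
qed


section \<open>Polynomial equations and general position\<close>

type_synonym 'm mpolynomial = "('m \<Rightarrow>\<^sub>0 nat) \<Rightarrow>\<^sub>0 complex"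

definition poly_eval :: "'m::finite mpolynomial \<Rightarrow> complex ^ 'm \<Rightarrow> complex" where
  "poly_eval p v = (\<Sum>m\<in>Poly_Mapping.keys p. Poly_Mapping.lookup p m * (\<Prod>k\<in>UNIV. (v $ k) ^ Poly_Mapping.lookup m k))"

definition algebraic_set :: "(complex ^ 'm::finite) set \<Rightarrow> bool" where
  "algebraic_set S \<longleftrightarrow> (\<exists>F. finite F \<and> S = {v. \<forall>p\<in>F. poly_eval p v = 0})"

text \<open>Countably many proper algebraic subsets have to be allowed: for \<open>N = 1\<close> the exceptional
  points are the roots of unity other than \<open>1\<close>, which lie in no single proper algebraic subset.\<close>

definition general_position :: "(complex ^ 'm::finite \<Rightarrow> bool) \<Rightarrow> bool" where
  "general_position P \<longleftrightarrow>
     (\<exists>Z :: nat \<Rightarrow> (complex ^ 'm) set.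
        (\<forall>n. algebraic_set (Z n) \<and> Z n \<noteq> UNIV) \<and> (\<forall>v. v \<notin> (\<Union>n. Z n) \<longrightarrow> P v))"

end

theory Submission
  imports Defs "Jordan_Normal_Form.Determinant"
begin

text \<open>
Each \<open>\<partial>\<^sub>i\<close> lowers the degree by one. Hence the homogeneous components of a constant are again
annihilated by all \<open>\<partial>\<^sub>i\<close>, and since a constant has no component in degree \<open>0\<close>, it suffices to look
for constants in a fixed degree \<open>n \<ge> 1\<close> (\<open>component_of_constant\<close>).

In degree \<open>n\<close> the equations \<open>\<partial>\<^sub>i C = 0\<close> are linear in the \<open>N\<^sup>n\<close> coefficients of \<open>C\<close>, with one
equation for each generator \<open>i\<close> and each word \<open>v\<close> of length \<open>n - 1\<close>. Numbering this equation by the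
word \<open>i v\<close> of length \<open>n\<close> makes the system square. Its matrix \<open>M\<^sub>n(q)\<close> is indexed by words of length
\<open>n\<close> on both sides and has entries that are polynomials in the \<open>q\<^sub>i\<^sub>j\<close>
(\<open>complex_polynomial_function_partial_coeff\<close>). A constant of degree \<open>n\<close> is a nonzero kernel vector of
this matrix (\<open>homogeneous_constant_iff_singular\<close>), so it exists exactly when the single polynomial
equation \<open>det M\<^sub>n(q) = 0\<close> holds (\<open>algebraic_set_singular\<close>).

None of these equations holds identically, because at \<open>q = 0\<close> the operator \<open>\<partial>\<^sub>i\<close> just removes a
leading \<open>\<xi>\<^sub>i\<close>, which makes \<open>M\<^sub>n(0)\<close> the identity matrix. So the exceptional points form a countable
union of proper algebraic subsets, one for each degree.
\<close>

section \<open>Polynomial functions on affine space\<close>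

definition complex_polynomial_function :: "(complex ^ 'm::finite \<Rightarrow> complex) \<Rightarrow> bool" where
  "complex_polynomial_function f \<longleftrightarrow> (\<exists>p. \<forall>v. f v = poly_eval p v)"

lemma poly_eval_superset:
  assumes "finite A" "Poly_Mapping.keys p \<subseteq> A"
  shows "poly_eval p v =
    (\<Sum>m\<in>A. Poly_Mapping.lookup p m * (\<Prod>k\<in>UNIV. vec_nth v k ^ Poly_Mapping.lookup m k))"
  unfolding poly_eval_def
  by (rule sum.mono_neutral_left) (use assms in \<open>auto simp: in_keys_iff\<close>)

lemma poly_eval_add: "poly_eval (p + r) v = poly_eval p v + poly_eval r v"
proof -
  let ?A = "Poly_Mapping.keys p \<union> Poly_Mapping.keys r"
  have "Poly_Mapping.keys (p + r) \<subseteq> ?A" by (rule keys_add)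
  then show ?thesis
    by (simp add: poly_eval_superset[of ?A] lookup_add distrib_right sum.distrib)
qed

lemma poly_eval_single:
  "poly_eval (Poly_Mapping.single m c) v =
    c * (\<Prod>k\<in>UNIV. vec_nth v k ^ Poly_Mapping.lookup m k)"
  by (subst poly_eval_superset[of "{m}"]) auto

lemma complex_polynomial_function_monomial:
  "complex_polynomial_function
    (\<lambda>v. c * (\<Prod>k\<in>UNIV. vec_nth v k ^ Poly_Mapping.lookup m k))"
  unfolding complex_polynomial_function_def
  by (intro exI[of _ "Poly_Mapping.single m c"]) (simp add: poly_eval_single)

lemma complex_polynomial_function_const: "complex_polynomial_function (\<lambda>v. c)"
  using complex_polynomial_function_monomial[of c 0] by simp

lemma complex_polynomial_function_coordinate: "complex_polynomial_function (\<lambda>v. vec_nth v k)"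
proof -
  have "(\<Prod>l\<in>UNIV. vec_nth v l ^ Poly_Mapping.lookup (Poly_Mapping.single k 1) l) = vec_nth v k"
    for v :: "complex ^ 'a"
  proof -
    have "(\<Prod>l\<in>UNIV. vec_nth v l ^ Poly_Mapping.lookup (Poly_Mapping.single k 1) l)
        = (\<Prod>l\<in>UNIV. if l = k then vec_nth v l else 1)"
      by (rule prod.cong) (auto simp: lookup_single)
    then show ?thesis by simp
  qed
  then show ?thesis
    using complex_polynomial_function_monomial[of 1 "Poly_Mapping.single k 1"] by simp
qed

lemma complex_polynomial_function_add:
  assumes "complex_polynomial_function f" "complex_polynomial_function g"
  shows "complex_polynomial_function (\<lambda>v. f v + g v)"
  using assms unfolding complex_polynomial_function_def by (metis poly_eval_add)

lemma complex_polynomial_function_sum: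
  assumes "\<And>a. a \<in> A \<Longrightarrow> complex_polynomial_function (f a)"
  shows "complex_polynomial_function (\<lambda>v. \<Sum>a\<in>A. f a v)"
  using assms
  by (induction A rule: infinite_finite_induct)
    (simp_all add: complex_polynomial_function_const complex_polynomial_function_add)

text \<open>The product of two monomials is the monomial of the added exponents, so the product of two
  polynomial functions expands into a sum of monomial functions.\<close>

lemma complex_polynomial_function_mult:
  assumes "complex_polynomial_function f" "complex_polynomial_function g"
  shows "complex_polynomial_function (\<lambda>v. f v * g v)"
proof -
  obtain p r where f: "f = poly_eval p" and g: "g = poly_eval r"
    using assms unfolding complex_polynomial_function_def by blast
  have "f v * g v = (\<Sum>m\<in>Poly_Mapping.keys p. \<Sum>n\<in>Poly_Mapping.keys r.
      (Poly_Mapping.lookup p m * Poly_Mapping.lookup r n) *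
      (\<Prod>k\<in>UNIV. vec_nth v k ^ Poly_Mapping.lookup (m + n) k))" for v
    unfolding f g poly_eval_def sum_product
    by (simp add: lookup_add power_add prod.distrib mult_ac)
  then show ?thesis
    by (simp only:) (intro complex_polynomial_function_sum complex_polynomial_function_monomial)
qed

lemma complex_polynomial_function_prod:
  assumes "\<And>a. a \<in> A \<Longrightarrow> complex_polynomial_function (f a)"
  shows "complex_polynomial_function (\<lambda>v. \<Prod>a\<in>A. f a v)"
  using assms
  by (induction A rule: infinite_finite_induct)
    (simp_all add: complex_polynomial_function_const complex_polynomial_function_mult)

lemma algebraic_set_zeros:
  assumes "complex_polynomial_function f"
  shows "algebraic_set {v. f v = 0}"
proof -
  obtain p where "\<And>v. f v = poly_eval p v"
    using assms unfolding complex_polynomial_function_def by blast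
  then show ?thesis
    unfolding algebraic_set_def by (intro exI[of _ "{p}"]) simp
qed

text \<open>For a square matrix a nontrivial kernel is one polynomial condition, the vanishing of the
  determinant, and the Leibniz formula shows that this determinant is polynomial in the parameters.
  Rows and columns carry a common finite index set \<open>A\<close>, because below they are words; only the proof
  enumerates \<open>A\<close> by an initial segment of the natural numbers.\<close>

lemma algebraic_set_singular:
  fixes M :: "'a \<Rightarrow> 'a \<Rightarrow> complex ^ 'm::finite \<Rightarrow> complex"
  assumes "finite A"
    and poly: "\<And>u w. u \<in> A \<Longrightarrow> w \<in> A \<Longrightarrow> complex_polynomial_function (M u w)"
  shows "algebraic_set {v. \<exists>c. (\<exists>w\<in>A. c w \<noteq> 0) \<and> (\<forall>u\<in>A. (\<Sum>w\<in>A. M u w v * c w) = 0)}"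
proof -
  obtain f where f: "bij_betw f {0..<card A} A"
    using ex_bij_betw_nat_finite[OF \<open>finite A\<close>] by blast
  define m where "m = card A"
  have f: "bij_betw f {0..<m} A" using f by (simp add: m_def)
  then have fA: "f i \<in> A" if "i < m" for i using that by (auto dest: bij_betwE)
  define B where "B v = mat m m (\<lambda>(i, j). M (f i) (f j) v)" for v
  have B: "B v \<in> carrier_mat m m" for v by (simp add: B_def)
  have "complex_polynomial_function (\<lambda>v. Determinant.det (B v))"
  proof -
    have "Determinant.det (B v) = (\<Sum>p\<in>{p. p permutes {0..<m}}.
        signof p * (\<Prod>i = 0..<m. M (f i) (f (p i)) v))" for v
      unfolding det_def'[OF B]
      by (intro sum.cong prod.cong arg_cong2[where f = times] refl)
        (auto simp: B_def dest: permutes_in_image[THEN iffD2])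
    moreover have "complex_polynomial_function (\<lambda>v. \<Sum>p\<in>{p. p permutes {0..<m}}.
        signof p * (\<Prod>i = 0..<m. M (f i) (f (p i)) v))"
      by (intro complex_polynomial_function_sum complex_polynomial_function_mult
          complex_polynomial_function_const complex_polynomial_function_prod poly fA)
        (auto dest: permutes_in_image[THEN iffD2])
    ultimately show ?thesis by simp
  qed
  moreover have "Determinant.det (B v) = 0 \<longleftrightarrow>
      (\<exists>c. (\<exists>w\<in>A. c w \<noteq> 0) \<and> (\<forall>u\<in>A. (\<Sum>w\<in>A. M u w v * c w) = 0))" for v
  proof -
    have row: "vec_index (B v *\<^sub>v x) i = (\<Sum>j = 0..<m. M (f i) (f j) v * vec_index x j)"
      if "x \<in> carrier_vec m" "i < m" for x i
      using that by (simp add: B_def scalar_prod_def)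
    have onA: "(\<Sum>w\<in>A. M u w v * c w) = (\<Sum>j = 0..<m. M u (f j) v * c (f j))" for u c
      using sum.reindex_bij_betw[OF f, of "\<lambda>w. M u w v * c w"] by simp
    show ?thesis
      unfolding det_0_iff_vec_prod_zero[OF B]
    proof (intro iffI; elim exE conjE)
      fix x assume x: "x \<in> carrier_vec m" "x \<noteq> 0\<^sub>v m" "B v *\<^sub>v x = 0\<^sub>v m"
      let ?c = "\<lambda>w. vec_index x (inv_into {0..<m} f w)"
      have cf: "?c (f j) = vec_index x j" if "j < m" for j
        using f that by (simp add: bij_betw_def inv_into_f_f)
      obtain j where "j < m" "vec_index x j \<noteq> 0"
        using x(1,2) by (metis carrier_vecD eq_vecI index_zero_vec)
      then have "\<exists>w\<in>A. ?c w \<noteq> 0" using cf fA by metis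
      moreover have "(\<Sum>w\<in>A. M u w v * ?c w) = 0" if "u \<in> A" for u
      proof -
        obtain i where "i < m" "u = f i"
          using f \<open>u \<in> A\<close> by (auto simp: bij_betw_def)
        then show ?thesis
          using row[OF x(1), of i] x(3) by (simp add: onA cf)
      qed
      ultimately show "\<exists>c. (\<exists>w\<in>A. c w \<noteq> 0) \<and> (\<forall>u\<in>A. (\<Sum>w\<in>A. M u w v * c w) = 0)"
        by (intro exI[of _ ?c] conjI ballI)
    next
      fix c assume c: "\<exists>w\<in>A. c w \<noteq> 0" "\<forall>u\<in>A. (\<Sum>w\<in>A. M u w v * c w) = 0"
      let ?x = "Matrix.vec m (\<lambda>j. c (f j))"
      obtain j where "j < m" "c (f j) \<noteq> 0"
        using c(1) f by (auto simp: bij_betw_def)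
      then have "?x \<noteq> 0\<^sub>v m" by (metis index_vec index_zero_vec(1))
      moreover have "B v *\<^sub>v ?x = 0\<^sub>v m"
      proof (rule eq_vecI)
        fix i assume "i < dim_vec (0\<^sub>v m :: complex Matrix.vec)"
        then show "vec_index (B v *\<^sub>v ?x) i = vec_index (0\<^sub>v m) i"
          using row[of ?x i] c(2) fA[of i] by (simp add: onA)
      qed (simp add: B_def)
      ultimately show "\<exists>x. x \<in> carrier_vec m \<and> x \<noteq> 0\<^sub>v m \<and> B v *\<^sub>v x = 0\<^sub>v m"
        by (intro exI[of _ ?x]) simp
    qed
  qed
  ultimately show ?thesis using algebraic_set_zeros by fastforce
qed

section \<open>Coefficients of the twisted derivations\<close>

text \<open>The matrix of \<open>\<partial>\<^sub>i\<close> in the basis of words, with row \<open>v\<close> and column \<open>w\<close>.\<close>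

definition partial_coeff ::
    "complex ^ ('n \<times> 'n) \<Rightarrow> 'n::finite \<Rightarrow> 'n word \<Rightarrow> 'n word \<Rightarrow> complex" where
  "partial_coeff q i v w = Poly_Mapping.lookup (partial_word q i (letters w)) v"

lemma lookup_partial:
  assumes "finite A" "Poly_Mapping.keys x \<subseteq> A"
  shows "Poly_Mapping.lookup (partial q i x) v =
    (\<Sum>w\<in>A. partial_coeff q i v w * Poly_Mapping.lookup x w)"
  by (simp add: partial_superset[OF assms] lookup_sum partial_coeff_def mult.commute)

lemma lookup_xi_mult:
  "Poly_Mapping.lookup (xi j * x) (Word u) =
    (case u of [] \<Rightarrow> 0 | k # v \<Rightarrow> if k = j then Poly_Mapping.lookup x (Word v) else 0)"
proof -
  have "xi j * x = (\<Sum>w\<in>Poly_Mapping.keys x.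
      Poly_Mapping.single (Word (j # letters w)) (Poly_Mapping.lookup x w))"
  proof -
    have "xi j * x = xi j * (\<Sum>w\<in>Poly_Mapping.keys x.
        smul (Poly_Mapping.lookup x w) (Poly_Mapping.single w 1))"
      by (simp flip: free_alg_expand)
    also have "\<dots> = (\<Sum>w\<in>Poly_Mapping.keys x.
        smul (Poly_Mapping.lookup x w) (xi j * Poly_Mapping.single w 1))"
      by (simp add: sum_distrib_left xi_mult_smul)
    also have "\<dots> = (\<Sum>w\<in>Poly_Mapping.keys x.
        Poly_Mapping.single (Word (j # letters w)) (Poly_Mapping.lookup x w))"
    proof (rule sum.cong)
      fix w
      show "smul (Poly_Mapping.lookup x w) (xi j * Poly_Mapping.single w 1) =
          Poly_Mapping.single (Word (j # letters w)) (Poly_Mapping.lookup x w)"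
        using xi_mult_single[of j "letters w" 1]
        by (intro poly_mapping_eqI) (simp add: lookup_single when_def)
    qed simp
    finally show ?thesis .
  qed
  then have "Poly_Mapping.lookup (xi j * x) (Word u) =
      (\<Sum>w\<in>Poly_Mapping.keys x. if Word (j # letters w) = Word u then Poly_Mapping.lookup x w else 0)"
    by (simp add: lookup_sum lookup_single when_def)
  also have "\<dots> =
      (case u of [] \<Rightarrow> 0 | k # v \<Rightarrow> if k = j then Poly_Mapping.lookup x (Word v) else 0)"
  proof (cases u)
    case (Cons k v)
    have "(\<Sum>w\<in>Poly_Mapping.keys x. if Word (j # letters w) = Word u then Poly_Mapping.lookup x w else 0)
      = (\<Sum>w\<in>Poly_Mapping.keys x. if w = Word v then if k = j then Poly_Mapping.lookup x w else 0 else 0)"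
    proof (rule sum.cong)
      fix w :: "'a word"
      show "(if Word (j # letters w) = Word u then Poly_Mapping.lookup x w else 0) =
          (if w = Word v then if k = j then Poly_Mapping.lookup x w else 0 else 0)"
        by (cases w) (auto simp: Cons)
    qed simp
    then show ?thesis
      by (simp add: Cons in_keys_iff)
  qed simp
  finally show ?thesis .
qed

lemma partial_coeff_Nil: "partial_coeff q i v (Word []) = 0"
  by (simp add: partial_coeff_def)

text \<open>The twisted Leibniz rule in coefficients. Degree, polynomial dependence on \<open>q\<close> and the value at
  \<open>q = 0\<close> are all read off from this recursion.\<close>

lemma partial_coeff_Cons:
  "partial_coeff q i (Word v) (Word (j # w)) =
    (if i = j \<and> v = w then 1 else 0)
    + vec_nth q (i, j) * (case v of [] \<Rightarrow> 0 | k # v' \<Rightarrow>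
        if k = j then partial_coeff q i (Word v') (Word w) else 0)"
  by (auto simp: partial_coeff_def lookup_add lookup_xi_mult lookup_single when_def split: list.split)

lemma partial_coeff_eq_0:
  "length w \<noteq> Suc (length v) \<Longrightarrow> partial_coeff q i (Word v) (Word w) = 0"
proof (induction w arbitrary: v)
  case (Cons j w)
  then show ?case by (cases v) (auto simp: partial_coeff_Cons)
qed (simp add: partial_coeff_Nil)

lemma complex_polynomial_function_partial_coeff:
  "complex_polynomial_function (\<lambda>q. partial_coeff q i (Word v) (Word w))"
proof (induction w arbitrary: v)
  case Nil
  then show ?case by (simp add: partial_coeff_Nil complex_polynomial_function_const)
next
  case (Cons j w)
  note IH = Cons.IH
  have "complex_polynomial_function (\<lambda>q. case v of [] \<Rightarrow> 0 | k # v' \<Rightarrow>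
      if k = j then partial_coeff q i (Word v') (Word w) else 0)"
  proof (cases v)
    case (Cons k v')
    then show ?thesis
      using IH by (cases "k = j") (simp_all add: complex_polynomial_function_const)
  qed (simp add: complex_polynomial_function_const)
  then show ?case
    unfolding partial_coeff_Cons
    by (intro complex_polynomial_function_add complex_polynomial_function_mult
        complex_polynomial_function_const complex_polynomial_function_coordinate)
qed

lemma partial_coeff_at_0:
  "partial_coeff 0 i (Word v) (Word w) = (if w = i # v then 1 else 0)"
  by (cases w) (auto simp: partial_coeff_Nil partial_coeff_Cons)

section \<open>Homogeneous constants\<close>

definition words :: "nat \<Rightarrow> 'n::finite word set" where
  "words n = {w. length (letters w) = n}"

lemma finite_words: "finite (words n :: 'n::finite word set)"
proof -
  have "words n = Word ` {u :: 'n list. set u \<subseteq> UNIV \<and> length u = n}"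
    by (auto simp: words_def image_iff) (metis word.collapse)
  then show ?thesis using finite_lists_length_eq[of "UNIV :: 'n set" n] by simp
qed

lemma homogeneous_iff_keys: "x \<in> homogeneous n \<longleftrightarrow> Poly_Mapping.keys x \<subseteq> words n"
  by (auto simp: homogeneous_def words_def)

lemma homogeneous_in_positive_part:
  "n \<ge> 1 \<Longrightarrow> x \<in> homogeneous n \<Longrightarrow> x \<in> positive_part"
  unfolding positive_part_def by (rule free_alg.span_base) auto

lemma positive_part_no_constant_term:
  assumes "x \<in> positive_part"
  shows "Poly_Mapping.lookup x (Word []) = 0"
  using assms unfolding positive_part_def
proof (induction rule: free_alg.span_induct_alt)
  case (step c x y)
  then obtain n where "n \<ge> 1" "x \<in> homogeneous n" by auto
  then have "Word [] \<notin> Poly_Mapping.keys x" by (auto simp: homogeneous_def)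
  then have "Poly_Mapping.lookup x (Word []) = 0" by (simp add: in_keys_iff)
  with step show ?case by (simp add: lookup_add)
qed simp

lift_definition component :: "nat \<Rightarrow> 'n::finite free_alg \<Rightarrow> 'n free_alg" is
  "\<lambda>n x w. if length (letters w) = n then x w else 0"
  by (erule rev_finite_subset) auto

lemma partial_component:
  "Poly_Mapping.lookup (partial q i (component n x)) (Word v) =
    (if Suc (length v) = n then Poly_Mapping.lookup (partial q i x) (Word v) else 0)"
proof -
  let ?A = "Poly_Mapping.keys x"
  have sub: "Poly_Mapping.keys (component n x) \<subseteq> ?A"
    by (auto simp: in_keys_iff component.rep_eq split: if_splits)
  have *: "partial_coeff q i (Word v) w * Poly_Mapping.lookup (component n x) w =
      (if Suc (length v) = n then partial_coeff q i (Word v) w * Poly_Mapping.lookup x w else 0)" for w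
    using partial_coeff_eq_0[of "letters w" v q i] by (auto simp: component.rep_eq)
  show ?thesis
    unfolding lookup_partial[OF finite_keys sub] lookup_partial[OF finite_keys order_refl, of q i x]
    by (simp add: *)
qed

text \<open>The operators are homogeneous of degree \<open>-1\<close>, so they map different components of \<open>C\<close> into
  different degrees, where no cancellation can occur. Any degree in which \<open>C\<close> has a nonzero coefficient
  therefore carries a constant.\<close>

lemma component_of_constant:
  assumes "C \<in> constants q"
  shows "\<exists>n\<ge>1. component n C \<in> constants q \<inter> homogeneous n"
proof -
  have C: "C \<in> positive_part" "C \<noteq> 0" "\<And>i. partial q i C = 0"
    using assms by (auto simp: constants_def)
  obtain w where w: "Poly_Mapping.lookup C w \<noteq> 0"
    using C(2) by (metis lookup_zero poly_mapping_eqI)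
  let ?n = "length (letters w)"
  have n: "?n \<ge> 1"
    using w positive_part_no_constant_term[OF C(1)]
    by (cases w) (auto simp: Suc_le_eq)
  have hom: "component ?n C \<in> homogeneous ?n"
    by (auto simp: homogeneous_def in_keys_iff component.rep_eq split: if_splits)
  have "Poly_Mapping.lookup (component ?n C) w \<noteq> 0"
    using w by (simp add: component.rep_eq)
  then have "component ?n C \<noteq> 0" by auto
  moreover have "partial q i (component ?n C) = 0" for i
  proof (rule poly_mapping_eqI)
    fix v
    show "Poly_Mapping.lookup (partial q i (component ?n C)) v = Poly_Mapping.lookup 0 v"
      using partial_component[of q i ?n C "letters v"] by (simp add: C(3))
  qed
  ultimately have "component ?n C \<in> constants q"
    using homogeneous_in_positive_part[OF n hom] by (auto simp: constants_def)
  with n hom show ?thesis by blast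
qed

text \<open>The row of the word \<open>i v\<close> is the equation that the coefficient of \<open>v\<close> in \<open>\<partial>\<^sub>i C\<close> vanishes.
  For \<open>n \<ge> 1\<close> every word of length \<open>n\<close> has this form in exactly one way, so there are as many equations
  as unknowns, which is what makes a determinant applicable.\<close>

lemma homogeneous_constant_iff_singular:
  fixes q :: "complex ^ ('n::finite \<times> 'n)"
  assumes n: "n \<ge> 1"
  shows "constants q \<inter> homogeneous n \<noteq> {} \<longleftrightarrow>
    (\<exists>c. (\<exists>w\<in>words n. c w \<noteq> 0) \<and> (\<forall>u\<in>words n.
      (\<Sum>w\<in>words n. partial_coeff q (hd (letters u)) (Word (tl (letters u))) w * c w) = 0))"
    (is "_ \<longleftrightarrow> (\<exists>c. ?nz c \<and> ?ker c)")
proof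
  assume "constants q \<inter> homogeneous n \<noteq> {}"
  then obtain C where C: "C \<noteq> 0" "\<forall>i. partial q i C = 0" "Poly_Mapping.keys C \<subseteq> words n"
    by (auto simp: constants_def homogeneous_iff_keys)
  have "?nz (Poly_Mapping.lookup C)"
    using C(1,3) by (metis in_keys_iff keys_eq_empty subsetD ex_in_conv)
  moreover have "?ker (Poly_Mapping.lookup C)"
    using lookup_partial[OF finite_words C(3), of q] by (simp add: C(2))
  ultimately show "\<exists>c. ?nz c \<and> ?ker c" by blast
next
  assume "\<exists>c. ?nz c \<and> ?ker c"
  then obtain c where c: "?nz c" "?ker c" by blast
  define C where "C = Abs_poly_mapping (\<lambda>w. if w \<in> words n then c w else 0)"
  have lookup_C: "Poly_Mapping.lookup C = (\<lambda>w. if w \<in> words n then c w else 0)"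
    unfolding C_def
    by (rule Abs_poly_mapping_inverse) (auto intro: rev_finite_subset[OF finite_words[of n]])
  have keys: "Poly_Mapping.keys C \<subseteq> words n"
    by (auto simp: in_keys_iff lookup_C split: if_splits)
  have "C \<noteq> 0" using c(1) lookup_C by (metis lookup_zero)
  moreover have "partial q i C = 0" for i
  proof (rule poly_mapping_eqI)
    fix v
    have sum: "Poly_Mapping.lookup (partial q i C) v = (\<Sum>w\<in>words n. partial_coeff q i v w * c w)"
      by (simp add: lookup_partial[OF finite_words keys] lookup_C)
    show "Poly_Mapping.lookup (partial q i C) v = Poly_Mapping.lookup 0 v"
    proof (cases "Suc (length (letters v)) = n")
      case True
      then have "Word (i # letters v) \<in> words n" by (simp add: words_def)
      from c(2)[rule_format, OF this] show ?thesis by (simp add: sum)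
    next
      case False
      have "partial_coeff q i v w = 0" if "w \<in> words n" for w
        using partial_coeff_eq_0[of "letters w" "letters v" q i] that False
        by (auto simp: words_def)
      then show ?thesis by (simp add: sum)
    qed
  qed
  ultimately have "C \<in> constants q"
    using homogeneous_in_positive_part[OF n, of C] keys
    by (simp add: constants_def homogeneous_iff_keys)
  then show "constants q \<inter> homogeneous n \<noteq> {}" using keys by (auto simp: homogeneous_iff_keys)
qed

lemma algebraic_set_homogeneous_constants:
  assumes "n \<ge> 1"
  shows "algebraic_set {q :: complex ^ ('n::finite \<times> 'n). constants q \<inter> homogeneous n \<noteq> {}}"
  unfolding homogeneous_constant_iff_singular[OF assms]
proof (rule algebraic_set_singular[OF finite_words])
  fix u w :: "'n word"
  show "complex_polynomial_function
      (\<lambda>q. partial_coeff q (hd (letters u)) (Word (tl (letters u))) w)"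
    using complex_polynomial_function_partial_coeff[of _ _ "letters w"] by simp
qed

text \<open>At \<open>q = 0\<close> the coefficient of \<open>v\<close> in \<open>\<partial>\<^sub>i C\<close> is the coefficient of \<open>i v\<close> in \<open>C\<close>, so the
  operators together see every coefficient of \<open>C\<close> except that of the empty word.\<close>

lemma constants_at_0: "constants (0 :: complex ^ ('n::finite \<times> 'n)) = {}"
proof -
  have False if "C \<in> constants 0" for C :: "'n free_alg"
  proof -
    have C: "C \<in> positive_part" "C \<noteq> 0" "\<And>i. partial 0 i C = 0"
      using that by (auto simp: constants_def)
    have "Poly_Mapping.lookup C (Word u) = 0" for u
    proof (cases u)
      case Nil
      then show ?thesis using positive_part_no_constant_term[OF C(1)] by simp
    next
      case (Cons i v)
      have "(\<Sum>w\<in>Poly_Mapping.keys C. partial_coeff 0 i (Word v) w * Poly_Mapping.lookup C w)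
          = (\<Sum>w\<in>Poly_Mapping.keys C. if w = Word u then Poly_Mapping.lookup C w else 0)"
      proof (rule sum.cong)
        fix w
        show "partial_coeff 0 i (Word v) w * Poly_Mapping.lookup C w =
            (if w = Word u then Poly_Mapping.lookup C w else 0)"
          using partial_coeff_at_0[of i v "letters w"] by (cases w) (simp add: Cons)
      qed simp
      also have "\<dots> = Poly_Mapping.lookup C (Word u)" by (simp add: in_keys_iff)
      finally show ?thesis
        using lookup_partial[OF finite_keys order_refl, of 0 i C "Word v"] by (simp add: C(3))
    qed
    then have "C = 0" by (metis lookup_zero poly_mapping_eqI word.collapse)
    with C(2) show False by simp
  qed
  then show ?thesis by blast
qed

theorem lemma1p2p2:
  shows "general_position (\<lambda>q :: complex ^ ('n::finite \<times> 'n). constants q = {})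
    \<and> {q :: complex ^ ('n \<times> 'n). constants q \<noteq> {}}
        = (\<Union>n\<in>{1..}. {q. constants q \<inter> homogeneous n \<noteq> {}})
    \<and> (\<forall>n\<ge>1. algebraic_set {q :: complex ^ ('n \<times> 'n). constants q \<inter> homogeneous n \<noteq> {}})"
proof -
  let ?E = "\<lambda>n. {q :: complex ^ ('n \<times> 'n). constants q \<inter> homogeneous n \<noteq> {}}"
  have union: "{q. constants q \<noteq> {}} = (\<Union>n\<in>{1..}. ?E n)"
  proof (intro equalityI subsetI)
    fix q :: "complex ^ ('n \<times> 'n)"
    assume "q \<in> {q. constants q \<noteq> {}}"
    then obtain C where "C \<in> constants q" by blast
    from component_of_constant[OF this] show "q \<in> (\<Union>n\<in>{1..}. ?E n)" by blast
  qed blast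
  \<comment> \<open>The sequence of algebraic sets starts at index \<open>0\<close>, the degrees start at \<open>1\<close>.\<close>
  have "general_position (\<lambda>q :: complex ^ ('n \<times> 'n). constants q = {})"
    unfolding general_position_def
  proof (intro exI conjI allI impI)
    fix n
    show "algebraic_set (?E (Suc n))" by (rule algebraic_set_homogeneous_constants) simp
    have "0 \<notin> ?E (Suc n)" by (simp add: constants_at_0)
    then show "?E (Suc n) \<noteq> UNIV" by blast
  next
    fix q :: "complex ^ ('n \<times> 'n)"
    assume q: "q \<notin> (\<Union>n. ?E (Suc n))"
    have "q \<notin> ?E n" if "n \<ge> 1" for n
      using q that by (cases n) auto
    then have "q \<notin> {q. constants q \<noteq> {}}" unfolding union by blast
    then show "constants q = {}" by blast
  qed
  with union algebraic_set_homogeneous_constants show ?thesis by blast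
qed

end
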